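(* Let $K\subset\mathbb{R}^3$ be a non-degenerate $3$-dimensional unbounded convex polyhedron. Then: (i) If $K$ has facets with non-parallel unbounded edges, then it can be placed in second trimming position with respect to any of them (that is, with respect to any facet that has two non-parallel unbounded edges). (ii) If all the unbounded edges of $K$ are parallel, then $K$ can be placed in second trimming position with respect to any of its bounded facets.
   Context: A convex polyhedron in $\mathbb{R}^n$ is a finite intersection of closed affine half-spaces. Its dimension is the dimension of its affine hull. Its faces are its intersections with supporting hyperplanes; facets of an $n$-dimensional polyhedron in $\mathbb{R}^n$ are its $(n-1)$-dimensional faces, edges are $1$-dimensional faces and vertices are $0$-dimensional faces. The polyhedron is non-degenerate if it has at least one vertex. Let $\pi_n:\mathbb{R}^n\to\mathbb{R}^{n-1}\times\{0\}$, $(x_1,\dots,x_n)\mapsto(x_1,\dots,x_{n-1},0)$. For a convex polyhedron $K\subset\mathbb{R}^n$ and $a\in\mathbb{R}^{n-1}$ put $I_a:=\pi_n^{-1}(a,0)\cap K$ and $\mathfrak{A}_K:=\{a\in\mathbb{R}^{n-1}:\ I_a\neq\varnothing,\ (a,0)\notin I_a\}$. An $n$-dimensional convex polyhedron $K\subset\mathbb{R}^n$ is in second trimming position with respect to its facet $F$ if: (1) $F\subset\{x_n=0\}$ and $K\subset\{x_n\le 0\}$; (2) the set $\mathfrak{A}_K$ is bounded. "$K$ can be placed in second trimming position with respect to $F$" means that there is an affine change of coordinates (affine bijection) $\phi:\mathbb{R}^n\to\mathbb{R}^n$ such that $\phi(K)$ is in second trimming position with respect to its facet $\phi(F)$. Here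 $n=3$. *)

theory Defs
  imports "HOL-Analysis.Analysis"
begin

(* Faces are taken in the sense of face_of, as in facet_of and edge_of. For a polyhedron these
   are the intersections with supporting hyperplanes, by exposed_face_of_polyhedron. *)

definition nondegenerate :: "'a::euclidean_space set \<Rightarrow> bool" where
  "nondegenerate K \<longleftrightarrow> (\<exists>V. V face_of K \<and> aff_dim V = 0)"

definition parallel_edges :: "'a::euclidean_space set \<Rightarrow> 'a set \<Rightarrow> bool" where
  "parallel_edges E E' \<longleftrightarrow> affine_parallel (affine hull E) (affine hull E')"

definition affine_bijection :: "('a::real_vector \<Rightarrow> 'a) \<Rightarrow> bool" where
  "affine_bijection \<phi> \<longleftrightarrow> bij \<phi> \<and> (\<exists>f c. linear f \<and> \<phi> = (\<lambda>x. f x + c))"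

definition proj3 :: "real^3 \<Rightarrow> real^3" where
  "proj3 x = vector [x $ 1, x $ 2, 0]"

definition emb3 :: "real^2 \<Rightarrow> real^3" where
  "emb3 a = vector [a $ 1, a $ 2, 0]"

definition vfibre :: "(real^3) set \<Rightarrow> real^2 \<Rightarrow> (real^3) set" where
  "vfibre K a = proj3 -` {emb3 a} \<inter> K"

definition trimming_set :: "(real^3) set \<Rightarrow> (real^2) set" where
  "trimming_set K = {a. vfibre K a \<noteq> {} \<and> emb3 a \<notin> vfibre K a}"

definition second_trimming_position :: "(real^3) set \<Rightarrow> (real^3) set \<Rightarrow> bool" where
  "second_trimming_position K F \<longleftrightarrow>
     polyhedron K \<and> aff_dim K = 3 \<and> F facet_of K \<and>
     F \<subseteq> {x. x $ 3 = 0} \<and> K \<subseteq> {x. x $ 3 \<le> 0} \<and>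
     bounded (trimming_set K)"

definition placeable_in_second_trimming_position :: "(real^3) set \<Rightarrow> (real^3) set \<Rightarrow> bool" where
  "placeable_in_second_trimming_position K F \<longleftrightarrow>
     (\<exists>\<phi>. affine_bijection \<phi> \<and> second_trimming_position (\<phi> ` K) (\<phi> ` F))"

end

theory Submission
  imports Defs
begin

text \<open>
  In case (i) let \<open>u\<^sub>1, u\<^sub>2\<close> be the directions of two non-parallel unbounded edges of the facet
  \<open>F = K \<inter> {h = c}\<close>, and let \<open>g\<^sub>1, g\<^sub>2\<close> be linear forms whose maxima on \<open>K\<close> are attained exactly on
  these edges. Suitably scaled and translated, \<open>(g\<^sub>2, g\<^sub>1, h)\<close> is an affine coordinate system in which
  \<open>u\<^sub>1, u\<^sub>2\<close> are the first two unit vectors and \<open>K\<close> projects into the quadrant \<open>x\<^sub>1, x\<^sub>2 \<ge> 0\<close>. As \<open>F\<close>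
  is stable under adding \<open>u\<^sub>1\<close> and \<open>u\<^sub>2\<close> and meets both axes, it covers this quadrant up to a
  bounded set.

  In case (ii) choose coordinates in which the common direction \<open>d\<close> of the unbounded edges is
  vertical; this is possible because \<open>F\<close> is bounded, so \<open>d\<close> is transversal to its plane. The
  projection of every edge is bounded, hence so is that of \<open>K\<close>: by induction on the dimension the
  projection of the relative frontier is bounded, and every point of \<open>K\<close> lies on a segment whose
  endpoints are in the relative frontier.
\<close>

section \<open>Recession directions, and linear images of polyhedra controlled by their
  edges\<close>

text \<open>The segments from \<open>p\<close> to ever farther points of the given ray contain
  points that converge to \<open>p + s *\<^sub>R w\<close>. Thus a ray at one point of a closed
  convex set makes its direction available at all points.\<close>

lemma closed_convex_add_direction:
  fixes S :: "'a::real_normed_vector set"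
  assumes S: "closed S" "convex S"
    and ray: "\<And>t. t \<ge> 0 \<Longrightarrow> x + t *\<^sub>R w \<in> S"
    and "p \<in> S" "s \<ge> 0"
  shows "p + s *\<^sub>R w \<in> S"
proof -
  define r where "r n = inverse (real (Suc n))" for n
  \<comment> \<open>The far point has parameter \<open>s * real (Suc n)\<close> and weight
    \<open>1 / Suc n\<close>, so its contribution along \<open>w\<close> is exactly \<open>s\<close>
    for every \<open>n\<close>.\<close>
  define q where "q n = (1 - r n) *\<^sub>R p + r n *\<^sub>R (x + (s * real (Suc n)) *\<^sub>R w)" for n
  have r: "0 \<le> r n" "r n \<le> 1" for n
    by (auto simp: r_def field_simps)
  have "q n \<in> S" for n
    unfolding q_def using r[of n] assms by (intro convexD[OF S(2)]) auto
  moreover have "q \<longlonglongrightarrow> (1 - 0) *\<^sub>R p + 0 *\<^sub>R x + s *\<^sub>R w"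
  proof -
    have "r \<longlonglongrightarrow> 0"
      unfolding r_def by (rule LIMSEQ_inverse_real_of_nat)
    then have "(\<lambda>n. (1 - r n) *\<^sub>R p + r n *\<^sub>R x + s *\<^sub>R w)
        \<longlonglongrightarrow> (1 - 0) *\<^sub>R p + 0 *\<^sub>R x + s *\<^sub>R w"
      by (intro tendsto_add tendsto_scaleR tendsto_diff tendsto_const)
    moreover have "q = (\<lambda>n. (1 - r n) *\<^sub>R p + r n *\<^sub>R x + s *\<^sub>R w)"
      by (auto simp: fun_eq_iff q_def r_def scaleR_add_right)
    ultimately show ?thesis by simp
  qed
  ultimately show ?thesis
    using closed_sequentially[OF S(1)] by fastforce
qed

text \<open>The largest parameter in \<open>[0, t]\<close> whose point is still in \<open>S\<close>
  yields the frontier point: at a relative interior point the ray could be continued inside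
  \<open>S\<close>, since it stays in the affine hull.\<close>

lemma ray_hits_rel_frontier:
  fixes S :: "'a::euclidean_space set"
  assumes "closed S" "x \<in> S" and line: "\<And>s. x + s *\<^sub>R w \<in> affine hull S"
    and t: "t \<ge> 0" "x + t *\<^sub>R w \<notin> S"
  obtains s where "s \<ge> 0" "x + s *\<^sub>R w \<in> rel_frontier S"
proof -
  define T where "T = {0..t} \<inter> (\<lambda>s. x + s *\<^sub>R w) -` S"
  have "compact T"
    unfolding T_def using assms(1)
    by (intro compact_Int_closed closed_vimage continuous_intros) auto
  moreover have "0 \<in> T"
    using assms by (auto simp: T_def)
  ultimately obtain m where m: "m \<in> T" "\<And>s. s \<in> T \<Longrightarrow> s \<le> m"
    using compact_attains_sup[of T] by blast
  have "m < t"
    using m(1) t by (auto simp: T_def order_le_less)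
  have "x + m *\<^sub>R w \<notin> rel_interior S"
  proof
    assume "x + m *\<^sub>R w \<in> rel_interior S"
    then obtain e where e: "e > 0" "ball (x + m *\<^sub>R w) e \<inter> affine hull S \<subseteq> S"
      by (auto simp: mem_rel_interior_ball)
    \<comment> \<open>Small enough to stay inside the ball and not to pass \<open>t\<close>; the
      summand 1 keeps the denominator positive when \<open>w = 0\<close>.\<close>
    define d where "d = min (t - m) (e / (2 * (norm w + 1)))"
    have d: "d > 0" "d \<le> t - m"
      using e \<open>m < t\<close> by (auto simp: d_def add_nonneg_pos)
    have "d * norm w \<le> e / (2 * (norm w + 1)) * norm w"
      by (intro mult_right_mono) (auto simp: d_def)
    also have "\<dots> = e * (norm w / (2 * (norm w + 1)))"
      by simp
    also have "\<dots> < e * 1"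
      using e by (intro mult_strict_left_mono) (auto simp: divide_less_eq add_nonneg_pos)
    finally have "x + (m + d) *\<^sub>R w \<in> ball (x + m *\<^sub>R w) e"
      using d by (simp add: dist_norm algebra_simps)
    then have "m + d \<in> T"
      using e(2) line[of "m + d"] d m(1) by (auto simp: T_def)
    then show False
      using m(2) d by fastforce
  qed
  moreover have "x + m *\<^sub>R w \<in> closure S"
    using m(1) closure_subset by (auto simp: T_def)
  ultimately show ?thesis
    using that[of m] m(1) by (auto simp: T_def rel_frontier_def)
qed

text \<open>
  If \<open>a\<close> exposes a vertex, then no direction orthogonal to \<open>a\<close> is a recession direction. Unlike
  the existence of a vertex, this condition passes to faces at once, which the induction needs.
\<close>

lemma bounded_linear_image_from_edges:
  fixes S :: "'a::euclidean_space set" and f :: "'a \<Rightarrow> 'b::euclidean_space"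
  assumes "polyhedron S" "linear f"
    and "\<And>x w. w \<noteq> 0 \<Longrightarrow> a \<bullet> w = 0 \<Longrightarrow> \<exists>t\<ge>0. x + t *\<^sub>R w \<notin> S"
    and "\<And>E. E edge_of S \<Longrightarrow> bounded (f ` E)"
  shows "bounded (f ` S)"
  using assms(1,3,4)
\<comment> \<open>The shift by one separates the empty set, of dimension -1, from a point.\<close>
proof (induction "nat (aff_dim S + 1)" arbitrary: S rule: less_induct)
  case less
  note poly = \<open>polyhedron S\<close> and noray = less.prems(2) and edges = less.prems(3)
  note closed = polyhedron_imp_closed[OF poly] and convex = polyhedron_imp_convex[OF poly]
  consider "aff_dim S = -1" | "aff_dim S = 0" | "aff_dim S = 1" | "aff_dim S \<ge> 2"
    using aff_dim_geq[of S] by linarith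
  then show ?case
  proof cases
    case 1
    then have "S = {}" by (simp add: aff_dim_empty)
    then show ?thesis by simp
  next
    case 2
    then obtain p where "S = {p}"
      using aff_dim_eq_0 by blast
    then show ?thesis by simp
  next
    case 3
    then show ?thesis
      using edges[of S] convex by (simp add: edge_of_def face_of_refl)
  next
    case 4
    have "bounded (f ` F)" if F: "F facet_of S" for F
    proof (rule less.hyps)
      show "nat (aff_dim F + 1) < nat (aff_dim S + 1)"
        using F 4 by (auto simp: facet_of_def)
      have face: "F face_of S" "F \<subseteq> S"
        using F facet_of_imp_face_of facet_of_imp_subset by blast+
      show "polyhedron F"
        using face poly face_of_polyhedron_polyhedron by blast
      show "\<exists>t\<ge>0. x + t *\<^sub>R w \<notin> F" if "w \<noteq> 0" "a \<bullet> w = 0" for x w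
        using noray[OF that] face by blast
      show "bounded (f ` E)" if "E edge_of F" for E
        using that edges[of E] face face_of_trans unfolding edge_of_def by blast
    qed
    moreover have "rel_frontier S = \<Union> {F. F facet_of S}" "finite {F. F facet_of S}"
      using poly by (simp_all add: rel_frontier_of_polyhedron finite_polyhedron_facets)
    ultimately have "bounded (f ` rel_frontier S)"
      by (simp add: image_Union bounded_Union)
    moreover have "f ` S \<subseteq> convex hull (f ` rel_frontier S)"
    proof clarify
      fix x assume x: "x \<in> S"
      \<comment> \<open>Since the affine hull has dimension at least 2, its section by the
        hyperplane through \<open>x\<close> with normal \<open>a\<close> is more than a point. A
        second point \<open>y\<close> there gives a direction orthogonal to \<open>a\<close>, and
        \<open>noray\<close> applies to it and to its opposite.\<close>
      let ?H = "affine hull S \<inter> {y. a \<bullet> y = a \<bullet> x}"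
      have xA: "x \<in> affine hull S"
        using x by (rule hull_inc)
      have "aff_dim ?H \<noteq> 0"
        using aff_dim_affine_Int_hyperplane[of "affine hull S" a "a \<bullet> x"] 4 xA by (auto split: if_splits)
      then have "?H \<noteq> {x}"
        using aff_dim_eq_0 by metis
      then obtain y where y: "y \<in> affine hull S" "a \<bullet> y = a \<bullet> x" "y \<noteq> x"
        using xA by blast
      have line: "x + s *\<^sub>R (y - x) \<in> affine hull S" "x + s *\<^sub>R (x - y) \<in> affine hull S" for s
        using xA y(1) by (auto intro: mem_affine_3_minus)
      obtain t where "t \<ge> 0" "x + t *\<^sub>R (y - x) \<notin> S"
        using noray[of "y - x" x] y by (auto simp: inner_diff_right)
      then obtain s where s: "s \<ge> 0" "x + s *\<^sub>R (y - x) \<in> rel_frontier S"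
        using ray_hits_rel_frontier[OF closed x line(1)] by blast
      obtain t where "t \<ge> 0" "x + t *\<^sub>R (x - y) \<notin> S"
        using noray[of "x - y" x] y by (auto simp: inner_diff_right)
      then obtain s' where s': "s' \<ge> 0" "x + s' *\<^sub>R (x - y) \<in> rel_frontier S"
        using ray_hits_rel_frontier[OF closed x line(2)] by blast
      show "f x \<in> convex hull (f ` rel_frontier S)"
      proof (cases "s + s' = 0")
        case True
        then have "s = 0"
          using s s' by linarith
        then show ?thesis
          using s by (auto intro!: hull_inc)
      next
        case False
        then have pos: "s + s' > 0"
          using s s' by simp
        define z z' where "z = x + s *\<^sub>R (y - x)" and "z' = x + s' *\<^sub>R (x - y)"
        \<comment> \<open>\<open>x\<close> divides the segment from \<open>z\<close> to
          \<open>z'\<close> in the ratio \<open>s : s'\<close>, so the weight of each endpoint is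
          proportional to the distance from the other.\<close>
        have "(s + s') *\<^sub>R x = s' *\<^sub>R z + s *\<^sub>R z'"
          by (simp add: z_def z'_def algebra_simps)
        then have "x = inverse (s + s') *\<^sub>R (s' *\<^sub>R z + s *\<^sub>R z')"
          using False by (metis left_inverse scaleR_one scaleR_scaleR)
        also have "\<dots> = (s' / (s + s')) *\<^sub>R z + (s / (s + s')) *\<^sub>R z'"
          by (simp add: scaleR_add_right divide_inverse mult.commute)
        finally have "f x = (s' / (s + s')) *\<^sub>R f z + (s / (s + s')) *\<^sub>R f z'"
          using \<open>linear f\<close> by (metis linear_add linear_cmul)
        moreover have "f z \<in> convex hull (f ` rel_frontier S)" "f z' \<in> convex hull (f ` rel_frontier S)"
          using s s' by (auto simp: z_def z'_def intro!: hull_inc)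
        ultimately show ?thesis
          using s s' pos by (auto intro!: convexD[OF convex_convex_hull] simp flip: add_divide_distrib)
      qed
    qed
    ultimately show ?thesis
      using bounded_convex_hull bounded_subset by blast
  qed
qed

section \<open>Unbounded edges, supporting hyperplanes and translations\<close>

text \<open>By convexity \<open>E\<close> is an interval of its line. If it contained neither
  half-line from \<open>p\<close>, it would lie in a compact segment.\<close>

lemma unbounded_convex_dim1_ray:
  fixes E :: "'a::euclidean_space set"
  assumes "convex E" "aff_dim E = 1" "\<not> bounded E"
  obtains p u where "u \<noteq> 0" "\<And>t. t \<ge> 0 \<Longrightarrow> p + t *\<^sub>R u \<in> E"
    "affine hull E = range (\<lambda>t. p + t *\<^sub>R u)"
proof -
  obtain p where p: "p \<in> E"
    using assms(2) by fastforce
  have "E \<noteq> {p}"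
    using assms(2) by auto
  then obtain q where q: "q \<in> E" "q \<noteq> p"
    using p by blast
  define w where "w = q - p"
  have "w \<noteq> 0"
    using q by (simp add: w_def)
  have "affine hull {p, q} = affine hull E"
    using p q assms(2) hull_mono[of "{p, q}" E affine]
    by (intro affine_dim_equal) (auto simp: aff_dim_2)
  then have hull: "affine hull E = range (\<lambda>t. p + t *\<^sub>R w)"
    using affine_hull_2_alt[of p q] by (simp add: w_def)
  have mono: "p + s *\<^sub>R v \<in> E" if "p + t *\<^sub>R v \<in> E" "0 \<le> s" "s \<le> t" for s t v
  proof (cases "t = 0")
    case False
    have "(1 - s / t) *\<^sub>R p + (s / t) *\<^sub>R (p + t *\<^sub>R v) \<in> E"
      using that False p by (intro convexD[OF assms(1)]) auto
    then show ?thesis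
      using False by (simp add: algebra_simps)
  qed (use that in auto)
  have "(\<forall>t\<ge>0. p + t *\<^sub>R w \<in> E) \<or> (\<forall>t\<ge>0. p + t *\<^sub>R (- w) \<in> E)"
  proof (rule ccontr)
    assume "\<not> ?thesis"
    then obtain t t' where t: "t \<ge> 0" "p + t *\<^sub>R w \<notin> E" and t': "t' \<ge> 0" "p + t' *\<^sub>R (- w) \<notin> E"
      by blast
    have "E \<subseteq> (\<lambda>s. p + s *\<^sub>R w) ` {-t'..t}"
    proof
      fix x assume x: "x \<in> E"
      then obtain s where s: "x = p + s *\<^sub>R w"
        using hull hull_inc[of x E affine] by auto
      have "s \<le> t"
        using mono[of s w t] t x s by (meson linear)
      moreover have "- s \<le> t'"
        using mono[of "- s" "- w" t'] t' x s by (metis linear scaleR_minus_left scaleR_minus_right minus_minus)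
      ultimately show "x \<in> (\<lambda>s. p + s *\<^sub>R w) ` {-t'..t}"
        using s by auto
    qed
    moreover have "bounded ((\<lambda>s. p + s *\<^sub>R w) ` {-t'..t})"
      by (intro compact_imp_bounded compact_continuous_image continuous_intros) auto
    ultimately show False
      using assms(3) bounded_subset by blast
  qed
  then show ?thesis
  proof
    assume "\<forall>t\<ge>0. p + t *\<^sub>R w \<in> E"
    then show ?thesis
      using that \<open>w \<noteq> 0\<close> hull by blast
  next
    assume *: "\<forall>t\<ge>0. p + t *\<^sub>R (- w) \<in> E"
    have "range (\<lambda>t. p + t *\<^sub>R w) = range (\<lambda>t. p + t *\<^sub>R (- w))"
    proof (intro set_eqI iffI; clarify)
      fix t
      show "p + t *\<^sub>R w \<in> range (\<lambda>t. p + t *\<^sub>R (- w))"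
        by (rule range_eqI[of _ _ "- t"]) simp
      show "p + t *\<^sub>R - w \<in> range (\<lambda>t. p + t *\<^sub>R w)"
        by (rule range_eqI[of _ _ "- t"]) simp
    qed
    then show ?thesis
      using that[of "- w" p] * \<open>w \<noteq> 0\<close> hull by auto
  qed
qed

lemma facet_supporting_hyperplane:
  fixes K :: "'a::euclidean_space set"
  assumes "polyhedron K" "F facet_of K"
  obtains h c where "h \<noteq> 0" "\<And>x. x \<in> K \<Longrightarrow> h \<bullet> x \<le> c" "F = K \<inter> {x. h \<bullet> x = c}"
proof -
  have "F exposed_face_of K"
    using assms exposed_face_of_polyhedron facet_of_imp_face_of by blast
  then obtain h c where hc: "K \<subseteq> {x. h \<bullet> x \<le> c}" "F = K \<inter> {x. h \<bullet> x = c}"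
    by (auto simp: exposed_face_of_def)
  \<comment> \<open>With \<open>h = 0\<close> the equation \<open>h \<bullet> x = c\<close> could
    cut out only the empty set or all of \<open>K\<close>.\<close>
  have "F \<noteq> {}" "F \<noteq> K"
    using assms(2) by (auto simp: facet_of_def)
  then have "h \<noteq> 0"
    using hc by auto
  then show ?thesis
    using that hc by blast
qed

lemma polyhedron_translation:
  fixes S :: "'a::euclidean_space set"
  assumes "polyhedron S"
  shows "polyhedron ((+) c ` S)"
proof -
  obtain H where H: "finite H" "S = \<Inter>H" "\<And>h. h \<in> H \<Longrightarrow> \<exists>a b. a \<noteq> 0 \<and> h = {x. a \<bullet> x \<le> b}"
    using assms unfolding polyhedron_def by metis
  have "(+) c ` \<Inter>H = \<Inter> (((`) ((+) c)) ` H)"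
    by (rule bij_image_INT[of "(+) c" id H, simplified])
  then have "(+) c ` S = \<Inter> (((`) ((+) c)) ` H)"
    using H(2) by simp
  moreover have "\<exists>a b. a \<noteq> 0 \<and> (+) c ` h = {x. a \<bullet> x \<le> b}" if "h \<in> H" for h
  proof -
    obtain a b where ab: "a \<noteq> 0" "h = {x. a \<bullet> x \<le> b}"
      using H(3)[OF \<open>h \<in> H\<close>] by blast
    have "(+) c ` h = {x. a \<bullet> x \<le> b + a \<bullet> c}"
    proof (intro set_eqI iffI)
      fix x assume "x \<in> {x. a \<bullet> x \<le> b + a \<bullet> c}"
      then have "x - c \<in> h" "x = c + (x - c)"
        using ab by (auto simp: inner_diff_right)
      then show "x \<in> (+) c ` h" by blast
    qed (use ab in \<open>auto simp: inner_add_right\<close>)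
    then show ?thesis using ab(1) by blast
  qed
  ultimately show ?thesis
    unfolding polyhedron_def using H(1)
    by (intro exI[of _ "((`) ((+) c)) ` H"]) auto
qed

section \<open>A coordinate criterion for second trimming position\<close>

text \<open>Reduces both cases to exhibiting coordinates. Hypothesis \<open>bnd\<close> says that a
  point whose foot in the plane of the facet is missing from the image lies over a fixed square,
  which therefore contains the trimming set.\<close>

lemma placeable_by_coordinates:
  fixes K :: "(real^3) set" and L :: "real^3 \<Rightarrow> real^3"
  assumes K: "polyhedron K" "aff_dim K = 3" "F facet_of K"
    and L: "linear L" "inj L"
    and le: "\<And>x. x \<in> K \<Longrightarrow> (L x + c) $ 3 \<le> 0"
    and eq: "\<And>x. x \<in> F \<Longrightarrow> (L x + c) $ 3 = 0"
    and bnd: "\<And>x. x \<in> K \<Longrightarrow> (\<bar>(L x + c) $ 1\<bar> \<le> M \<and> \<bar>(L x + c) $ 2\<bar> \<le> M)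
        \<or> vector [(L x + c) $ 1, (L x + c) $ 2, 0] \<in> (\<lambda>x. L x + c) ` K"
  shows "placeable_in_second_trimming_position K F"
proof -
  define \<phi> where "\<phi> = (\<lambda>x. L x + c)"
  have image: "\<phi> ` S = (+) c ` L ` S" for S
    by (auto simp: \<phi>_def image_image add.commute)
  have "surj L"
    using L by (simp add: linear_injective_imp_surjective)
  have "bij \<phi>"
  proof (rule bijI)
    show "inj \<phi>"
      using L(2) by (auto simp: \<phi>_def inj_on_def)
    have "range \<phi> = (+) c ` range L"
      by (rule image)
    then show "surj \<phi>"
      using \<open>surj L\<close> by simp
  qed
  then have "affine_bijection \<phi>"
    unfolding affine_bijection_def \<phi>_def using L(1) by blast
  moreover have "polyhedron (\<phi> ` K)"
    unfolding image using K(1) L \<open>surj L\<close>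
    by (simp add: polyhedron_translation polyhedron_linear_image_eq bij_def)
  moreover have dim: "aff_dim (\<phi> ` S) = aff_dim S" for S
    unfolding image using L by (simp add: aff_dim_translation_eq)
  moreover have "\<phi> ` F facet_of \<phi> ` K"
    using K(3) dim L unfolding facet_of_def
    by (simp add: image face_of_linear_image)
  moreover have "bounded (trimming_set (\<phi> ` K))"
  proof -
    have "norm a \<le> M + M" if a: "a \<in> trimming_set (\<phi> ` K)" for a
    proof -
      obtain x where x: "x \<in> K" "proj3 (\<phi> x) = emb3 a"
        using a by (auto simp: trimming_set_def vfibre_def)
      then have comp: "\<phi> x $ 1 = a $ 1" "\<phi> x $ 2 = a $ 2"
        by (auto simp: proj3_def emb3_def vec_eq_iff forall_3)
      \<comment> \<open>\<open>proj3\<close> fixes \<open>emb3 a\<close>, so absence from the fibre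
        is absence from the whole image.\<close>
      have "emb3 a \<notin> \<phi> ` K"
        using a by (auto simp: trimming_set_def vfibre_def proj3_def emb3_def)
      then have "\<bar>a $ 1\<bar> \<le> M" "\<bar>a $ 2\<bar> \<le> M"
        using bnd[OF x(1)] comp by (auto simp: \<phi>_def emb3_def)
      then show ?thesis
        using norm_le_l1_cart[of a] by (simp add: sum_2)
    qed
    then show ?thesis
      by (auto simp: bounded_iff)
  qed
  ultimately show ?thesis
    unfolding placeable_in_second_trimming_position_def second_trimming_position_def
    using le eq K(2) by (intro exI[of _ \<phi>]) (auto simp: \<phi>_def)
qed

section \<open>Case (i): a facet with two non-parallel unbounded edges\<close>

text \<open>An edge of the face is also a face of \<open>K\<close>, hence exposed in
  \<open>K\<close> by some \<open>g\<close>, which is constant along \<open>u\<close>. Moving from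
  \<open>p\<close> by the recession direction \<open>u'\<close> stays in \<open>K\<close> but leaves
  the line of \<open>E\<close>, so \<open>g\<close> drops strictly.\<close>

lemma edge_functional:
  fixes K F E :: "'a::euclidean_space set"
  assumes "polyhedron K" "F face_of K" "E edge_of F"
    and u: "\<And>t. t \<ge> 0 \<Longrightarrow> p + t *\<^sub>R u \<in> E" "affine hull E = range (\<lambda>t. p + t *\<^sub>R u)"
    and u': "\<And>t. t \<ge> 0 \<Longrightarrow> p' + t *\<^sub>R u' \<in> F" "\<And>s. u' \<noteq> s *\<^sub>R u"
  shows "\<exists>g. (\<forall>x\<in>K. g \<bullet> x \<le> g \<bullet> p) \<and> g \<bullet> u = 0 \<and> g \<bullet> u' < 0"
proof -
  have E: "E \<subseteq> F" "F \<subseteq> K"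
    using assms(2,3) by (simp_all add: face_of_imp_subset edge_of_imp_subset)
  have "E face_of K"
    using assms(2,3) face_of_trans by (auto simp: edge_of_def)
  then have "E exposed_face_of K"
    using exposed_face_of_polyhedron[OF assms(1)] by simp
  then obtain g c where g: "K \<subseteq> {x. g \<bullet> x \<le> c}" "E = K \<inter> {x. g \<bullet> x = c}"
    by (auto simp: exposed_face_of_def)
  have p: "p \<in> E" "p + u \<in> E"
    using u(1)[of 0] u(1)[of 1] by auto
  have "p + 1 *\<^sub>R u' \<in> K"
  proof (rule closed_convex_add_direction)
    show "p' + t *\<^sub>R u' \<in> K" if "t \<ge> 0" for t
      using u'(1)[OF that] E by blast
  qed (use p E assms(1) in \<open>auto simp: polyhedron_imp_closed polyhedron_imp_convex\<close>)
  moreover have "p + u' \<notin> E"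
  proof
    assume "p + u' \<in> E"
    then obtain s where "p + u' = p + s *\<^sub>R u"
      using u(2) hull_inc[of "p + u'" E affine] by blast
    then show False
      using u'(2) by simp
  qed
  ultimately have "g \<bullet> (p + u') < c"
    using g by auto
  then show ?thesis
    using p g by (intro exI[of _ g]) (auto simp: inner_add_right)
qed

lemma facet_with_nonparallel_unbounded_edges_placeable:
  fixes K :: "(real^3) set"
  assumes K: "polyhedron K" "aff_dim K = 3" and F: "F facet_of K"
    and E: "E edge_of F" "\<not> bounded E" and E': "E' edge_of F" "\<not> bounded E'"
    and nonpar: "\<not> parallel_edges E E'"
  shows "placeable_in_second_trimming_position K F"
proof -
  note face = facet_of_imp_face_of[OF F]
  have edge: "convex D" "aff_dim D = 1" if "D edge_of F" for D
    using that face_of_imp_convex by (auto simp: edge_of_def)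
  obtain p1 u1 where u1: "u1 \<noteq> 0" "\<And>t. t \<ge> 0 \<Longrightarrow> p1 + t *\<^sub>R u1 \<in> E"
      "affine hull E = range (\<lambda>t. p1 + t *\<^sub>R u1)"
    by (rule unbounded_convex_dim1_ray[OF edge[OF E(1)] E(2)]) blast
  obtain p2 u2 where u2: "u2 \<noteq> 0" "\<And>t. t \<ge> 0 \<Longrightarrow> p2 + t *\<^sub>R u2 \<in> E'"
      "affine hull E' = range (\<lambda>t. p2 + t *\<^sub>R u2)"
    by (rule unbounded_convex_dim1_ray[OF edge[OF E'(1)] E'(2)]) blast
  have indep1: "u1 \<noteq> s *\<^sub>R u2" for s
  proof
    assume s: "u1 = s *\<^sub>R u2"
    with u1 have "s \<noteq> 0" by auto
    have "affine hull E' = (+) (p2 - p1) ` (affine hull E)"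
    proof (intro set_eqI iffI)
      fix x assume "x \<in> affine hull E'"
      then obtain t where "x = p2 + t *\<^sub>R u2"
        using u2(3) by auto
      then have "x = (p2 - p1) + (p1 + (t / s) *\<^sub>R u1)"
        using s \<open>s \<noteq> 0\<close> by simp
      then show "x \<in> (+) (p2 - p1) ` (affine hull E)"
        using u1(3) by blast
    qed (use u1(3) u2(3) s in auto)
    then show False
      using nonpar by (auto simp: parallel_edges_def affine_parallel_def)
  qed
  have indep2: "u2 \<noteq> s *\<^sub>R u1" for s
  proof
    assume s: "u2 = s *\<^sub>R u1"
    then have "u1 = (1 / s) *\<^sub>R u2"
      using u2(1) by auto
    then show False
      using indep1 by blast
  qed
  have E_F: "E \<subseteq> F" "E' \<subseteq> F" "F \<subseteq> K"
    using E(1) E'(1) F edge_of_imp_subset facet_of_imp_subset by blast+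
  have ray1: "p1 + t *\<^sub>R u1 \<in> F" and ray2: "p2 + t *\<^sub>R u2 \<in> F" if "t \<ge> 0" for t
    using u1(2)[OF that] u2(2)[OF that] E_F by blast+
  obtain g1 where g1: "\<forall>x\<in>K. g1 \<bullet> x \<le> g1 \<bullet> p1" "g1 \<bullet> u1 = 0" "g1 \<bullet> u2 < 0"
    using edge_functional[OF K(1) face E(1) u1(2,3) ray2 indep2] by blast
  obtain g2 where g2: "\<forall>x\<in>K. g2 \<bullet> x \<le> g2 \<bullet> p2" "g2 \<bullet> u2 = 0" "g2 \<bullet> u1 < 0"
    using edge_functional[OF K(1) face E'(1) u2(2,3) ray1 indep1] by blast
  obtain h c where h: "h \<noteq> 0" "\<And>x. x \<in> K \<Longrightarrow> h \<bullet> x \<le> c" "F = K \<inter> {x. h \<bullet> x = c}"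
    by (rule facet_supporting_hyperplane[OF K(1) F]) blast
  have p: "p1 \<in> F" "p1 + u1 \<in> F" "p2 \<in> F" "p2 + u2 \<in> F"
    using u1(2)[of 0] u1(2)[of 1] u2(2)[of 0] u2(2)[of 1] E_F by auto
  then have hu: "h \<bullet> u1 = 0" "h \<bullet> u2 = 0" "h \<bullet> p1 = c" "h \<bullet> p2 = c"
    using h(3) by (auto simp: inner_add_right)
  \<comment> \<open>The scaling makes \<open>A\<close>, \<open>B\<close> dual to \<open>u1\<close>,
    \<open>u2\<close>. The factors are negative, so the maxima of \<open>g2\<close> at
    \<open>p2\<close> and of \<open>g1\<close> at \<open>p1\<close> become minima of
    \<open>A\<close> and \<open>B\<close> on \<open>K\<close>.\<close>
  define A where "A = (1 / (g2 \<bullet> u1)) *\<^sub>R g2"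
  define B where "B = (1 / (g1 \<bullet> u2)) *\<^sub>R g1"
  have AB: "A \<bullet> u1 = 1" "A \<bullet> u2 = 0" "B \<bullet> u1 = 0" "B \<bullet> u2 = 1"
    using g1 g2 by (auto simp: A_def B_def)
  have ge: "A \<bullet> x \<ge> A \<bullet> p2" "B \<bullet> x \<ge> B \<bullet> p1" if "x \<in> K" for x
    using that g1(1,3) g2(1,3)
    by (auto simp: A_def B_def divide_right_mono_neg)
  define L :: "real^3 \<Rightarrow> real^3" where "L x = vector [A \<bullet> x, B \<bullet> x, h \<bullet> x]" for x
  define d :: "real^3" where "d = vector [- (A \<bullet> p2), - (B \<bullet> p1), - c]"
  have L_d: "(L x + d) $ 1 = A \<bullet> x - A \<bullet> p2" "(L x + d) $ 2 = B \<bullet> x - B \<bullet> p1"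
      "(L x + d) $ 3 = h \<bullet> x - c" for x
    by (auto simp: L_def d_def)
  have lin: "linear L"
    by (rule linearI) (auto simp: L_def vec_eq_iff forall_3 inner_add_right)
  moreover have "inj L"
  proof (rule linear_surjective_imp_injective[OF lin])
    have "y \<in> range L" for y
    proof -
      define r where "r = y $ 3 / (h \<bullet> h)"
      \<comment> \<open>The multiple of \<open>h\<close> sets the third coordinate;
        \<open>u1\<close> and \<open>u2\<close>, orthogonal to \<open>h\<close>, then correct the
        other two independently.\<close>
      have "L (r *\<^sub>R h + (y $ 1 - r * (A \<bullet> h)) *\<^sub>R u1 + (y $ 2 - r * (B \<bullet> h)) *\<^sub>R u2) = y"
        using hu AB h(1) by (auto simp: L_def vec_eq_iff forall_3 inner_add_right r_def)
      then show ?thesis by (metis rangeI)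
    qed
    then show "surj L" by blast
  qed auto
  \<comment> \<open>In the new coordinates \<open>p1\<close> and \<open>p2\<close> lie on the two
    axes, and \<open>M\<close> is the larger of their distances from the origin.\<close>
  moreover define M where "M = max (A \<bullet> p1 - A \<bullet> p2) (B \<bullet> p2 - B \<bullet> p1)"
  have "(\<bar>(L x + d) $ 1\<bar> \<le> M \<and> \<bar>(L x + d) $ 2\<bar> \<le> M)
      \<or> vector [(L x + d) $ 1, (L x + d) $ 2, 0] \<in> (\<lambda>x. L x + d) ` K" if x: "x \<in> K" for x
  proof -
    have add: "q + s *\<^sub>R u1 + t *\<^sub>R u2 \<in> K" if "q \<in> K" "s \<ge> 0" "t \<ge> 0" for q s t
    proof -
      note add_dir = closed_convex_add_direction[OF polyhedron_imp_closed[OF K(1)] polyhedron_imp_convex[OF K(1)]]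
      have "q + s *\<^sub>R u1 \<in> K"
        using ray1 E_F(3) by (intro add_dir[OF _ that(1,2)]) blast
      then show ?thesis
        using ray2 E_F(3) by (intro add_dir[OF _ _ that(3)]) blast+
    qed
    have onto: "vector [(L x + d) $ 1, (L x + d) $ 2, 0] \<in> (\<lambda>x. L x + d) ` K"
      if q: "q \<in> F" "A \<bullet> q \<le> A \<bullet> x" "B \<bullet> q \<le> B \<bullet> x" for q
    proof (rule image_eqI)
      \<comment> \<open>\<open>?z\<close> has the \<open>A\<close> and \<open>B\<close> values of
        \<open>x\<close> but stays in the plane of \<open>F\<close>; its coefficients are
        nonnegative, so it is reached from \<open>q\<close> along recession directions.\<close>
      let ?z = "q + (A \<bullet> x - A \<bullet> q) *\<^sub>R u1 + (B \<bullet> x - B \<bullet> q) *\<^sub>R u2"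
      show "vector [(L x + d) $ 1, (L x + d) $ 2, 0] = L ?z + d"
        using q(1) h(3) by (simp add: vec_eq_iff forall_3 L_d inner_add_right AB hu del: vector_add_component)
      show "?z \<in> K"
        using add q E_F by auto
    qed
    \<comment> \<open>In the first two cases take \<open>q\<close> to be \<open>p1\<close> or
      \<open>p2\<close>; the other required inequality is the minimality in \<open>ge\<close>. In
      the last case \<open>x\<close> projects into the square.\<close>
    consider "A \<bullet> p1 \<le> A \<bullet> x" | "B \<bullet> p2 \<le> B \<bullet> x" | "A \<bullet> x < A \<bullet> p1" "B \<bullet> x < B \<bullet> p2"
      by linarith
    then show ?thesis
      by cases (use onto p ge[OF x] in \<open>auto simp: L_d M_def simp del: vector_add_component\<close>)
  qed
  ultimately show ?thesis
    using h by (intro placeable_by_coordinates[OF K F, of L d M]) (auto simp: L_d simp del: vector_add_component)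
qed

section \<open>Case (ii): parallel unbounded edges and a bounded facet\<close>

lemma bounded_facet_placeable:
  fixes K :: "(real^3) set"
  assumes K: "polyhedron K" "aff_dim K = 3" "nondegenerate K" "\<not> bounded K"
    and par: "\<And>E E'. \<lbrakk>E edge_of K; E' edge_of K; \<not> bounded E; \<not> bounded E'\<rbrakk> \<Longrightarrow> parallel_edges E E'"
    and F: "F facet_of K" "bounded F"
  shows "placeable_in_second_trimming_position K F"
proof -
  note closed = polyhedron_imp_closed[OF K(1)] and convex = polyhedron_imp_convex[OF K(1)]
  obtain v where "{v} face_of K"
    using K(3) aff_dim_eq_0 unfolding nondegenerate_def by metis
  then have "{v} exposed_face_of K"
    using K(1) exposed_face_of_polyhedron by blast
  then obtain a b where v: "{v} = K \<inter> {x. a \<bullet> x = b}"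
    by (auto simp: exposed_face_of_def)
  then have vK: "v \<in> K"
    by blast
  \<comment> \<open>Such a ray would put \<open>v + w\<close> into \<open>K\<close> and into the
    hyperplane that meets \<open>K\<close> only in \<open>v\<close>.\<close>
  have noray: "\<exists>t\<ge>0. x + t *\<^sub>R w \<notin> K" if w: "w \<noteq> 0" "a \<bullet> w = 0" for x w
  proof (rule ccontr)
    assume "\<not> ?thesis"
    then have "v + 1 *\<^sub>R w \<in> K"
      by (intro closed_convex_add_direction[OF closed convex _ vK, of x]) simp_all
    then have "v + w \<in> {v}"
      using v w by (auto simp: inner_add_right)
    then show False
      using w by simp
  qed
  note edges_suffice = bounded_linear_image_from_edges[OF K(1) _ noray]
  have edge: "convex D" "aff_dim D = 1" "D \<subseteq> K" if "D edge_of K" for D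
    using that face_of_imp_convex edge_of_imp_subset[OF that] by (auto simp: edge_of_def)
  \<comment> \<open>Applied to the identity map, the edge criterion says that bounded edges alone
    would make \<open>K\<close> bounded.\<close>
  obtain E where E: "E edge_of K" "\<not> bounded E"
    using edges_suffice[of "\<lambda>x. x"] K(4) by (auto simp: linear_ident)
  obtain p d where d: "d \<noteq> 0" "\<And>t. t \<ge> 0 \<Longrightarrow> p + t *\<^sub>R d \<in> E"
      "affine hull E = range (\<lambda>t. p + t *\<^sub>R d)"
    by (rule unbounded_convex_dim1_ray[OF edge(1,2)[OF E(1)] E(2)]) blast
  obtain h c where h: "h \<noteq> 0" "\<And>x. x \<in> K \<Longrightarrow> h \<bullet> x \<le> c" "F = K \<inter> {x. h \<bullet> x = c}"
    by (rule facet_supporting_hyperplane[OF K(1) F(1)]) blast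
  have hd: "h \<bullet> d \<noteq> 0"
  proof
    assume hd: "h \<bullet> d = 0"
    obtain q where q: "q \<in> F"
      using F(1) by (auto simp: facet_of_def)
    have "q + t *\<^sub>R d \<in> F" if "t \<ge> 0" for t
      using closed_convex_add_direction[OF closed convex, of p d q t] that q d(2) edge(3)[OF E(1)] h(3) hd
      by (auto simp: inner_add_right)
    moreover obtain r where r: "\<And>x. x \<in> F \<Longrightarrow> norm x \<le> r"
      using F(2) by (auto simp: bounded_iff)
    ultimately have bd: "norm (q + t *\<^sub>R d) \<le> r" if "t \<ge> 0" for t
      using that by blast
    \<comment> \<open>Chosen so that \<open>t *\<^sub>R d\<close> is longer than
      \<open>2 * r\<close>, although it is the difference of two points of \<open>F\<close>, each of
      norm at most \<open>r\<close>.\<close>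
    define t where "t = (2 * r + 1) / norm d"
    have "r \<ge> 0"
      using r[OF q] norm_ge_zero order_trans by blast
    then have "norm (t *\<^sub>R d) = 2 * r + 1" "t \<ge> 0"
      using d(1) by (auto simp: t_def)
    moreover have "norm (t *\<^sub>R d) \<le> norm (q + t *\<^sub>R d) + norm q"
      by (metis add_diff_cancel_left' norm_triangle_ineq4)
    ultimately show False
      using bd[of t] r[OF q] by linarith
  qed
  \<comment> \<open>The vertical vector is given the length of \<open>d\<close>, so that an
    orthogonal transformation can carry \<open>d\<close> to it.\<close>
  define e :: "real^3" where "e = norm d *\<^sub>R axis 3 1"
  have "norm d = norm e"
    by (simp add: e_def norm_axis_1)
  then obtain Q where Q: "orthogonal_transformation Q" "Q d = e"
    using orthogonal_transformation_exists[of d e] by blast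
  have linQ: "linear Q"
    using Q(1) by (rule orthogonal_transformation_linear)
  define f :: "real^3 \<Rightarrow> real^3" where "f x = proj3 (Q x)" for x
  have linf: "linear f"
    by (rule linearI)
       (auto simp: f_def proj3_def vec_eq_iff forall_3 linear_add[OF linQ] linear_cmul[OF linQ])
  have fd: "f d = 0"
    by (auto simp: f_def Q(2) e_def proj3_def vec_eq_iff forall_3 axis_def)
  have "bounded (f ` D)" if D: "D edge_of K" for D
  proof (cases "bounded D")
    case True
    then show ?thesis
      using bounded_linear_image linf linear_conv_bounded_linear by blast
  next
    case False
    then obtain s where s: "affine hull D = (+) s ` (affine hull E)"
      using par[OF E(1) D E(2)] by (auto simp: parallel_edges_def affine_parallel_def)
    \<comment> \<open>An unbounded edge is parallel to \<open>d\<close>, which \<open>f\<close>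
      kills, so its image is a single point.\<close>
    have "f ` D \<subseteq> {f (s + p)}"
    proof clarify
      fix x assume "x \<in> D"
      then obtain t where "x = s + (p + t *\<^sub>R d)"
        using s d(3) hull_inc[of x D affine] by auto
      then show "f x = f (s + p)"
        by (simp add: linear_add[OF linf] linear_cmul[OF linf] fd)
    qed
    then show ?thesis
      using bounded_subset bounded_insert bounded_empty by metis
  qed
  then have "bounded (f ` K)"
    by (intro edges_suffice linf)
  then obtain M where M: "\<And>x. x \<in> K \<Longrightarrow> norm (f x) \<le> M"
    by (auto simp: bounded_iff)
  \<comment> \<open>Replacing the third coordinate of \<open>Q\<close> by \<open>h\<close> makes the
    plane of \<open>F\<close> horizontal and keeps \<open>d\<close> vertical. Injectivity survives
    because \<open>d\<close> spans the common kernel of the first two coordinates and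
    \<open>h \<bullet> d\<close> is nonzero.\<close>
  define L :: "real^3 \<Rightarrow> real^3" where "L x = vector [Q x $ 1, Q x $ 2, h \<bullet> x]" for x
  have linL: "linear L"
    by (rule linearI)
       (auto simp: L_def vec_eq_iff forall_3 linear_add[OF linQ] linear_cmul[OF linQ] inner_add_right)
  have "inj L"
    unfolding linear_injective_0[OF linL]
  proof clarify
    fix x assume "L x = 0"
    then have x: "Q x $ 1 = 0" "Q x $ 2 = 0" "h \<bullet> x = 0"
      by (auto simp: L_def vec_eq_iff forall_3)
    define k where "k = Q x $ 3 / norm d"
    have "Q x = k *\<^sub>R e"
      using x d(1) by (auto simp: k_def e_def vec_eq_iff forall_3 axis_def)
    then have "Q x = Q (k *\<^sub>R d)"
      by (simp add: linear_cmul[OF linQ] Q(2))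
    then have xk: "x = k *\<^sub>R d"
      using orthogonal_transformation_inj[OF Q(1)] by (simp add: inj_def)
    then show "x = 0"
      using x(3) hd by simp
  qed
  define c' :: "real^3" where "c' = vector [0, 0, - c]"
  have comp: "(L x + c') $ 1 = f x $ 1" "(L x + c') $ 2 = f x $ 2" "(L x + c') $ 3 = h \<bullet> x - c" for x
    by (auto simp: L_def c'_def f_def proj3_def)
  \<comment> \<open>The whole projection of \<open>K\<close> is bounded, so the first alternative of
    \<open>bnd\<close> holds at every point.\<close>
  have "\<bar>f x $ i\<bar> \<le> M" if "x \<in> K" for x i
    using component_le_norm_cart[of "f x" i] M[OF that] by linarith
  then show ?thesis
    using h linL \<open>inj L\<close>
    by (intro placeable_by_coordinates[OF K(1,2) F(1), of L c' M]) (auto simp: comp simp del: vector_add_component)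
qed

theorem proposition2:
  fixes K :: "(real^3) set"
  assumes "polyhedron K" and "aff_dim K = 3" and "nondegenerate K" and "\<not> bounded K"
  shows "(\<forall>F. F facet_of K \<and>
              (\<exists>E E'. E edge_of F \<and> E' edge_of F \<and> \<not> bounded E \<and> \<not> bounded E' \<and>
                      \<not> parallel_edges E E')
            \<longrightarrow> placeable_in_second_trimming_position K F)
       \<and> ((\<forall>E E'. E edge_of K \<and> E' edge_of K \<and> \<not> bounded E \<and> \<not> bounded E'
                  \<longrightarrow> parallel_edges E E')
            \<longrightarrow> (\<forall>F. F facet_of K \<and> bounded F
                  \<longrightarrow> placeable_in_second_trimming_position K F))"
proof (intro conjI allI impI; elim conjE exE)
  fix F E E'
  assume "F facet_of K" "E edge_of F" "E' edge_of F" "\<not> bounded E" "\<not> bounded E'"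
    and "\<not> parallel_edges E E'"
  then show "placeable_in_second_trimming_position K F"
    using facet_with_nonparallel_unbounded_edges_placeable[OF assms(1,2)] by simp
next
  fix F
  assume par: "\<forall>E E'. E edge_of K \<and> E' edge_of K \<and> \<not> bounded E \<and> \<not> bounded E'
      \<longrightarrow> parallel_edges E E'"
    and F: "F facet_of K" "bounded F"
  show "placeable_in_second_trimming_position K F"
    by (rule bounded_facet_placeable[OF assms _ F]) (simp add: par)
qed

end
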